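(* Let $\mu_1$ and $\mu_2$ be scaling functions. If the limit relation $$\lim_{n,m \to \infty} \frac{\mu_1(n)\mu_2(m)}{\mu_2(n)\mu_1(m)}=1$$ holds, then we have the equality $\mathbf{P}_{\mu_1}(E) = \mathbf{P}_{\mu_2}(E)$ for every $E \subseteq \mathbb{N}$.
   Context: $\mathbb{R}^+=[0,\infty)$. A scaling function is a strictly decreasing function $\mu:\mathbb{N}\to\mathbb{R}^+$ with $\lim_{n\to\infty}\mu(n)=0$. For $E\subseteq\mathbb{N}$ and $n\in\mathbb{N}$, $$\lambda_\mu(E,n)=\sup\{|\mu(n^{(1)})-\mu(n^{(2)})| : n\le n^{(1)}<n^{(2)},\ n^{(1)},n^{(2)}\in\mathbb{N},\ (n^{(1)},n^{(2)})\cap E=\emptyset\}.$$ A number $p$ is a porosity number of $E$ at infinity (w.r.t. $\mu$) if there is a strictly increasing sequence $(n_k)_{k\in\mathbb{N}}$ of natural numbers with $p=\lim_{k\to\infty}\lambda_\mu(E,n_k)/\mu(n_k)$; $\mathbf{P}_\mu(E)$ is the set of all porosity numbers of $E$ at infinity. The limit as $n,m\to\infty$ is the double limit in which $n$ and $m$ tend to infinity independently. *)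

theory Defs
  imports "HOL-Analysis.Analysis"
begin

definition scaling_function :: "(nat \<Rightarrow> real) \<Rightarrow> bool" where
  "scaling_function \<mu> \<longleftrightarrow>
     (\<forall>n. 0 \<le> \<mu> n) \<and> strict_antimono_on UNIV \<mu> \<and> \<mu> \<longlonglongrightarrow> 0"

(* For a scaling function the supremum is that of a set which is nonempty (take
   n1 = n, n2 = n + 1, where the open interval contains no natural number) and
   bounded above by \<mu> n; outside that case Sup may be unspecified. *)
definition lambda_mu :: "(nat \<Rightarrow> real) \<Rightarrow> nat set \<Rightarrow> nat \<Rightarrow> real" where
  "lambda_mu \<mu> E n =
     Sup {\<bar>\<mu> n1 - \<mu> n2\<bar> | n1 n2. n \<le> n1 \<and> n1 < n2 \<and> {n1<..<n2} \<inter> E = {}}"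

definition porosity_number :: "(nat \<Rightarrow> real) \<Rightarrow> nat set \<Rightarrow> real \<Rightarrow> bool" where
  "porosity_number \<mu> E p \<longleftrightarrow>
     (\<exists>s :: nat \<Rightarrow> nat. strict_mono s \<and>
        (\<lambda>k. lambda_mu \<mu> E (s k) / \<mu> (s k)) \<longlonglongrightarrow> p)"

definition porosity_numbers :: "(nat \<Rightarrow> real) \<Rightarrow> nat set \<Rightarrow> real set" where
  "porosity_numbers \<mu> E = {p. porosity_number \<mu> E p}"

end

theory Submission
  imports Defs
begin

text \<open>
  Taking the first index equal to \<open>a\<close> and the second equal to \<open>n \<le> a\<close>, the double limit says
  that \<open>\<mu>1 a / \<mu>1 n\<close> and \<open>\<mu>2 a / \<mu>2 n\<close> have quotient close to 1; as both lie in \<open>[0, 1]\<close>, they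
  differ by at most \<open>\<epsilon>\<close>, uniformly in \<open>a \<ge> n \<ge> N\<close>. Hence normalised gap lengths with respect to
  \<open>\<mu>1\<close> and \<open>\<mu>2\<close> differ by at most \<open>2 * \<epsilon>\<close>, and so do their suprema.
\<close>

lemma scaling_function_less:
  assumes "scaling_function \<mu>" "m < n"
  shows "\<mu> n < \<mu> m"
  using assms by (auto simp: scaling_function_def monotone_on_def)

lemma scaling_function_antimono:
  assumes "scaling_function \<mu>" "m \<le> n"
  shows "\<mu> n \<le> \<mu> m"
  using scaling_function_less[OF assms(1), of m n] assms(2) by (cases "m = n") auto

lemma scaling_function_nonneg: "scaling_function \<mu> \<Longrightarrow> 0 \<le> \<mu> n"
  by (simp add: scaling_function_def)

text \<open>Strict decrease puts \<open>\<mu> n\<close> above the nonnegative value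
  \<open>\<mu> (Suc n)\<close>. This justifies every later division by
  \<open>\<mu> n\<close>.\<close>

lemma scaling_function_pos: "scaling_function \<mu> \<Longrightarrow> 0 < \<mu> n"
  using scaling_function_less[of \<mu> n "Suc n"] scaling_function_nonneg[of \<mu> "Suc n"] by simp

lemma lambda_mu_upper:
  assumes "scaling_function \<mu>" "n \<le> a" "a < b" "{a<..<b} \<inter> E = {}"
  shows "\<bar>\<mu> a - \<mu> b\<bar> \<le> lambda_mu \<mu> E n"
  unfolding lambda_mu_def
proof (rule cSup_upper)
  \<comment> \<open>Both values lie between 0 and \<open>\<mu> n\<close>, hence so does their
    distance; this is the bound that \<open>cSup_upper\<close> requires.\<close>
  have "\<bar>\<mu> i - \<mu> j\<bar> \<le> \<mu> n" if "n \<le> i" "i < j" for i j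
    using scaling_function_antimono[OF assms(1) that(1)] scaling_function_less[OF assms(1) that(2)]
      scaling_function_nonneg[OF assms(1), of j] by simp
  then show "bdd_above {\<bar>\<mu> n1 - \<mu> n2\<bar> | n1 n2. n \<le> n1 \<and> n1 < n2 \<and> {n1<..<n2} \<inter> E = {}}"
    by (intro bdd_aboveI[of _ "\<mu> n"]) auto
qed (use assms in blast)

lemma lambda_mu_least:
  assumes "\<And>a b. n \<le> a \<Longrightarrow> a < b \<Longrightarrow> {a<..<b} \<inter> E = {} \<Longrightarrow> \<bar>\<mu> a - \<mu> b\<bar> \<le> c"
  shows "lambda_mu \<mu> E n \<le> c"
  unfolding lambda_mu_def
proof (rule cSup_least)
  \<comment> \<open>Consecutive indices are admissible for every \<open>E\<close>, so the supremum
    is over a nonempty set.\<close>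
  have "{n<..<Suc n} \<inter> E = {}" by auto
  then show "{\<bar>\<mu> n1 - \<mu> n2\<bar> | n1 n2. n \<le> n1 \<and> n1 < n2 \<and> {n1<..<n2} \<inter> E = {}} \<noteq> {}"
    using lessI by blast
qed (use assms in blast)

text \<open>Each endpoint of a gap contributes an error of at most \<open>e\<close>, whence
  \<open>2 * e\<close>. The index \<open>n\<close> is fixed, and the reverse estimate follows by
  exchanging the two scaling functions.\<close>

lemma normalised_lambda_mu_le:
  assumes s1: "scaling_function \<mu>1" and s2: "scaling_function \<mu>2"
    and close: "\<And>a. n \<le> a \<Longrightarrow> \<bar>\<mu>1 a / \<mu>1 n - \<mu>2 a / \<mu>2 n\<bar> \<le> e"
  shows "lambda_mu \<mu>1 E n / \<mu>1 n \<le> lambda_mu \<mu>2 E n / \<mu>2 n + 2 * e"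
proof -
  note pos = scaling_function_pos[OF s1, of n] scaling_function_pos[OF s2, of n]
  \<comment> \<open>Clearing the denominator leaves a bare supremum, which can be bounded gap by
    gap.\<close>
  have "lambda_mu \<mu>1 E n \<le> (lambda_mu \<mu>2 E n / \<mu>2 n + 2 * e) * \<mu>1 n"
  proof (rule lambda_mu_least)
    fix a b assume ab: "n \<le> a" "a < b" "{a<..<b} \<inter> E = {}"
    have "\<bar>\<mu>1 a - \<mu>1 b\<bar> / \<mu>1 n = \<bar>\<mu>1 a / \<mu>1 n - \<mu>1 b / \<mu>1 n\<bar>"
      using pos by (simp flip: diff_divide_distrib)
    also have "\<dots> \<le> \<bar>\<mu>2 a / \<mu>2 n - \<mu>2 b / \<mu>2 n\<bar> + 2 * e"
      using close[of a] close[of b] ab by linarith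
    also have "\<bar>\<mu>2 a / \<mu>2 n - \<mu>2 b / \<mu>2 n\<bar> = \<bar>\<mu>2 a - \<mu>2 b\<bar> / \<mu>2 n"
      using pos by (simp flip: diff_divide_distrib)
    also have "\<dots> \<le> lambda_mu \<mu>2 E n / \<mu>2 n"
      using lambda_mu_upper[OF s2 ab] pos by (simp add: divide_right_mono)
    finally show "\<bar>\<mu>1 a - \<mu>1 b\<bar> \<le> (lambda_mu \<mu>2 E n / \<mu>2 n + 2 * e) * \<mu>1 n"
      using pos by (simp add: pos_divide_le_eq)
  qed
  then show ?thesis
    using pos by (simp add: pos_divide_le_eq)
qed

lemma scaling_quotients_uniformly_close:
  assumes s1: "scaling_function \<mu>1" and s2: "scaling_function \<mu>2"
    and lim: "((\<lambda>(n, m). (\<mu>1 n * \<mu>2 m) / (\<mu>2 n * \<mu>1 m)) \<longlongrightarrow> 1) (sequentially \<times>\<^sub>F sequentially)"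
    and "e > 0"
  obtains N where "\<And>n a. N \<le> n \<Longrightarrow> n \<le> a \<Longrightarrow> \<bar>\<mu>1 a / \<mu>1 n - \<mu>2 a / \<mu>2 n\<bar> \<le> e"
proof -
  \<comment> \<open>The two indices of the double limit are independent, so one \<open>N\<close>
    serves all \<open>a\<close> and \<open>n\<close> beyond it, however far apart they are.\<close>
  obtain N where N: "\<bar>\<mu>1 a * \<mu>2 n / (\<mu>2 a * \<mu>1 n) - 1\<bar> < e" if "N \<le> a" "N \<le> n" for a n
    using tendstoD[OF lim \<open>e > 0\<close>]
    by (auto simp: eventually_prod_sequentially dist_real_def)
  have "\<bar>\<mu>1 a / \<mu>1 n - \<mu>2 a / \<mu>2 n\<bar> \<le> e" if "N \<le> n" "n \<le> a" for n a
  proof -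
    note pos = scaling_function_pos[OF s1, of n] scaling_function_pos[OF s2, of n]
      scaling_function_pos[OF s2, of a]
    have q: "0 \<le> \<mu>2 a / \<mu>2 n" "\<mu>2 a / \<mu>2 n \<le> 1"
      using pos scaling_function_antimono[OF s2 that(2)] by auto
    \<comment> \<open>Factoring out \<open>\<mu>2 a / \<mu>2 n\<close>, which is at most 1, turns
      the relative error into an absolute one.\<close>
    have "\<mu>1 a / \<mu>1 n - \<mu>2 a / \<mu>2 n
        = (\<mu>1 a * \<mu>2 n / (\<mu>2 a * \<mu>1 n) - 1) * (\<mu>2 a / \<mu>2 n)"
      using pos by (simp add: field_simps)
    then have "\<bar>\<mu>1 a / \<mu>1 n - \<mu>2 a / \<mu>2 n\<bar>
        = \<bar>\<mu>1 a * \<mu>2 n / (\<mu>2 a * \<mu>1 n) - 1\<bar> * (\<mu>2 a / \<mu>2 n)"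
      using q(1) by (simp only: abs_mult abs_of_nonneg)
    also have "\<dots> \<le> e * 1"
      using N[of a n] that q \<open>e > 0\<close> by (intro mult_mono) auto
    finally show ?thesis by simp
  qed
  with that show ?thesis by blast
qed

lemma normalised_lambda_mu_diff_tendsto_0:
  assumes s1: "scaling_function \<mu>1" and s2: "scaling_function \<mu>2"
    and lim: "((\<lambda>(n, m). (\<mu>1 n * \<mu>2 m) / (\<mu>2 n * \<mu>1 m)) \<longlongrightarrow> 1) (sequentially \<times>\<^sub>F sequentially)"
  shows "(\<lambda>n. lambda_mu \<mu>1 E n / \<mu>1 n - lambda_mu \<mu>2 E n / \<mu>2 n) \<longlonglongrightarrow> 0"
proof (rule LIMSEQ_I)
  fix r :: real assume "0 < r"
  \<comment> \<open>The choice \<open>r / 3\<close> keeps the total error \<open>2 * (r / 3)\<close>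
    strictly below \<open>r\<close>.\<close>
  then have "0 < r / 3" by simp
  obtain N where N: "\<And>n a. N \<le> n \<Longrightarrow> n \<le> a \<Longrightarrow> \<bar>\<mu>1 a / \<mu>1 n - \<mu>2 a / \<mu>2 n\<bar> \<le> r / 3"
    using scaling_quotients_uniformly_close[OF s1 s2 lim \<open>0 < r / 3\<close>] by blast
  have "norm (lambda_mu \<mu>1 E n / \<mu>1 n - lambda_mu \<mu>2 E n / \<mu>2 n - 0) < r" if "N \<le> n" for n
  proof -
    have "lambda_mu \<mu>1 E n / \<mu>1 n \<le> lambda_mu \<mu>2 E n / \<mu>2 n + 2 * (r / 3)"
      using N[OF that] by (rule normalised_lambda_mu_le[OF s1 s2])
    moreover have "lambda_mu \<mu>2 E n / \<mu>2 n \<le> lambda_mu \<mu>1 E n / \<mu>1 n + 2 * (r / 3)"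
      using N[OF that] by (intro normalised_lambda_mu_le[OF s2 s1]) (simp add: abs_minus_commute)
    ultimately show ?thesis
      using \<open>0 < r\<close> unfolding real_norm_def by linarith
  qed
  then show "\<exists>N. \<forall>n\<ge>N. norm (lambda_mu \<mu>1 E n / \<mu>1 n - lambda_mu \<mu>2 E n / \<mu>2 n - 0) < r"
    by blast
qed

theorem theorem4p7:
  fixes \<mu>1 \<mu>2 :: "nat \<Rightarrow> real"
  assumes "scaling_function \<mu>1" and "scaling_function \<mu>2"
    and "((\<lambda>(n, m). (\<mu>1 n * \<mu>2 m) / (\<mu>2 n * \<mu>1 m)) \<longlongrightarrow> 1) (sequentially \<times>\<^sub>F sequentially)"
  shows "\<forall>E :: nat set. porosity_numbers \<mu>1 E = porosity_numbers \<mu>2 E"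
proof
  fix E :: "nat set"
  \<comment> \<open>The same index sequence \<open>s\<close> witnesses \<open>p\<close> for both
    scaling functions, since the difference of the normalised values still tends to 0 along
    \<open>s\<close>.\<close>
  have "(\<lambda>k. lambda_mu \<mu>1 E (s k) / \<mu>1 (s k)) \<longlonglongrightarrow> p \<longleftrightarrow>
      (\<lambda>k. lambda_mu \<mu>2 E (s k) / \<mu>2 (s k)) \<longlonglongrightarrow> p" if "strict_mono s" for s p
  proof (rule Lim_transform_eq)
    show "(\<lambda>k. lambda_mu \<mu>1 E (s k) / \<mu>1 (s k) - lambda_mu \<mu>2 E (s k) / \<mu>2 (s k)) \<longlonglongrightarrow> 0"
      using LIMSEQ_subseq_LIMSEQ[OF normalised_lambda_mu_diff_tendsto_0[OF assms] that]
      by (simp add: o_def)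
  qed
  then show "porosity_numbers \<mu>1 E = porosity_numbers \<mu>2 E"
    unfolding porosity_numbers_def porosity_number_def by blast
qed

end
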